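(* Let $\lambda_1,\lambda_2,\lambda_3\in\mathbb{R}$, let $\mathbb{K}$ be the associated algebra of 3-parameter generalized quaternions, and let $p\in\mathbb{K}$ with $N_p=1$. Let $\mathcal{A}dp$ denote the $3\times3$ matrix, with respect to the basis $\{e_1,e_2,e_3\}$, of the linear map $\mathrm{Im}(\mathbb{K})\to\mathrm{Im}(\mathbb{K})$, $q\mapsto pqp^{-1}$, and let $$\varepsilon=\begin{bmatrix}\lambda_1\lambda_2&0&0\\0&\lambda_1\lambda_3&0\\0&0&\lambda_2\lambda_3\end{bmatrix}.$$ Then $(\mathcal{A}dp)^{T}\,\varepsilon\,\mathcal{A}dp=\varepsilon$.
   Context: Given $\lambda_1,\lambda_2,\lambda_3\in\mathbb{R}$, $\mathbb{K}$ is the (associative, unital) real algebra with vector-space basis $1,e_1,e_2,e_3$, unit $1$, and bilinear multiplication determined by $e_1^2=-\lambda_1\lambda_2$, $e_2^2=-\lambda_1\lambda_3$, $e_3^2=-\lambda_2\lambda_3$, $e_1e_2=\lambda_1e_3=-e_2e_1$, $e_2e_3=\lambda_3e_1=-e_3e_2$, $e_3e_1=\lambda_2e_2=-e_1e_3$. For $p=a_0+a_1e_1+a_2e_2+a_3e_3\in\mathbb{K}$ (with $a_i\in\mathbb{R}$), the conjugate is $\bar p=a_0-a_1e_1-a_2e_2-a_3e_3$, the norm is $N_p=p\bar p=a_0^2+\lambda_1\lambda_2a_1^2+\lambda_1\lambda_3a_2^2+\lambda_2\lambda_3a_3^2$, and $p^{-1}=\bar p$ when $N_p=1$. $\mathrm{Im}(\mathbb{K})=\{a_1e_1+a_2e_2+a_3e_3:a_i\in\mathbb{R}\}$.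 Explicitly, $$\mathcal{A}dp=\begin{bmatrix}a_0^2+\lambda_1\lambda_2a_1^2-\lambda_1\lambda_3a_2^2-\lambda_2\lambda_3a_3^2&2\lambda_1\lambda_3a_1a_2-2\lambda_3a_0a_3&2\lambda_2\lambda_3a_1a_3+2\lambda_3a_0a_2\\2\lambda_1\lambda_2a_1a_2+2\lambda_2a_0a_3&a_0^2-\lambda_1\lambda_2a_1^2+\lambda_1\lambda_3a_2^2-\lambda_2\lambda_3a_3^2&2\lambda_2\lambda_3a_2a_3-2\lambda_2a_0a_1\\2\lambda_1\lambda_2a_1a_3-2\lambda_1a_0a_2&2\lambda_1\lambda_3a_2a_3+2\lambda_1a_0a_1&a_0^2-\lambda_1\lambda_2a_1^2-\lambda_1\lambda_3a_2^2+\lambda_2\lambda_3a_3^2\end{bmatrix}$$ (columns are the images of $e_1,e_2,e_3$). *)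

theory Defs
  imports "HOL-Analysis.Analysis"
begin

text \<open>
  The 3-parameter generalized quaternions.  The underlying real vector space does not depend on
  \<open>\<lambda>\<^sub>1, \<lambda>\<^sub>2, \<lambda>\<^sub>3\<close>: the pair \<open>(a\<^sub>0, a)\<close> stands for \<open>a\<^sub>0 + a\<^sub>1 e\<^sub>1 + a\<^sub>2 e\<^sub>2 + a\<^sub>3 e\<^sub>3\<close>.
  Only the multiplication depends on the parameters, which are therefore explicit arguments
  \<open>l1 l2 l3\<close>.
\<close>

type_synonym gquat = "real \<times> (real ^ 3)"

definition gq_one :: gquat where
  "gq_one = (1, 0)"

definition gq_e :: "3 \<Rightarrow> gquat" where
  "gq_e i = (0, axis i 1)"

definition gq_Im :: "gquat set" where
  "gq_Im = {q. fst q = 0}"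

text \<open>The bilinear extension of the multiplication table, which is recovered in
  \<open>gq_mult_table\<close> below.\<close>

definition gq_mult :: "real \<Rightarrow> real \<Rightarrow> real \<Rightarrow> gquat \<Rightarrow> gquat \<Rightarrow> gquat" where
  "gq_mult l1 l2 l3 p q =
    (let a0 = fst p; a1 = snd p $ 1; a2 = snd p $ 2; a3 = snd p $ 3;
         b0 = fst q; b1 = snd q $ 1; b2 = snd q $ 2; b3 = snd q $ 3
     in (a0 * b0 - l1 * l2 * a1 * b1 - l1 * l3 * a2 * b2 - l2 * l3 * a3 * b3,
         vector [a0 * b1 + a1 * b0 + l3 * (a2 * b3 - a3 * b2),
                 a0 * b2 + a2 * b0 + l2 * (a3 * b1 - a1 * b3),
                 a0 * b3 + a3 * b0 + l1 * (a1 * b2 - a2 * b1)]))"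

definition gq_conj :: "gquat \<Rightarrow> gquat" where
  "gq_conj p = (fst p, - snd p)"

definition gq_norm :: "real \<Rightarrow> real \<Rightarrow> real \<Rightarrow> gquat \<Rightarrow> real" where
  "gq_norm l1 l2 l3 p =
    (fst p)\<^sup>2 + l1 * l2 * (snd p $ 1)\<^sup>2 + l1 * l3 * (snd p $ 2)\<^sup>2 + l2 * l3 * (snd p $ 3)\<^sup>2"

text \<open>Unspecified if \<open>p\<close> is not invertible.\<close>

definition gq_inv :: "real \<Rightarrow> real \<Rightarrow> real \<Rightarrow> gquat \<Rightarrow> gquat" where
  "gq_inv l1 l2 l3 p =
    (THE q. gq_mult l1 l2 l3 p q = gq_one \<and> gq_mult l1 l2 l3 q p = gq_one)"

text \<open>
  Column \<open>j\<close> holds the coordinates of \<open>p e\<^sub>j p\<^sup>-\<^sup>1\<close> in the basis \<open>e\<^sub>1, e\<^sub>2, e\<^sub>3\<close>.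
  The library's \<open>representation\<close> is \<open>0\<close> outside the span of the basis; by
  \<open>gq_span\<close> and \<open>gq_conjugation_Im\<close> below, this does not happen when the norm of \<open>p\<close> is 1.
\<close>

definition gq_Ad :: "real \<Rightarrow> real \<Rightarrow> real \<Rightarrow> gquat \<Rightarrow> real ^ 3 ^ 3" where
  "gq_Ad l1 l2 l3 p =
    (\<chi> i j. representation (range gq_e)
              (gq_mult l1 l2 l3 (gq_mult l1 l2 l3 p (gq_e j)) (gq_inv l1 l2 l3 p)) (gq_e i))"

definition gq_eps :: "real \<Rightarrow> real \<Rightarrow> real \<Rightarrow> real ^ 3 ^ 3" where
  "gq_eps l1 l2 l3 = vector [vector [l1 * l2, 0, 0],
                             vector [0, l1 * l3, 0],
                             vector [0, 0, l2 * l3]]"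

lemma gq_mult_table:
  "gq_mult l1 l2 l3 (gq_e 1) (gq_e 1) = - (l1 * l2) *\<^sub>R gq_one"
  "gq_mult l1 l2 l3 (gq_e 2) (gq_e 2) = - (l1 * l3) *\<^sub>R gq_one"
  "gq_mult l1 l2 l3 (gq_e 3) (gq_e 3) = - (l2 * l3) *\<^sub>R gq_one"
  "gq_mult l1 l2 l3 (gq_e 1) (gq_e 2) = l1 *\<^sub>R gq_e 3"
  "gq_mult l1 l2 l3 (gq_e 2) (gq_e 1) = - l1 *\<^sub>R gq_e 3"
  "gq_mult l1 l2 l3 (gq_e 2) (gq_e 3) = l3 *\<^sub>R gq_e 1"
  "gq_mult l1 l2 l3 (gq_e 3) (gq_e 2) = - l3 *\<^sub>R gq_e 1"
  "gq_mult l1 l2 l3 (gq_e 3) (gq_e 1) = l2 *\<^sub>R gq_e 2"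
  "gq_mult l1 l2 l3 (gq_e 1) (gq_e 3) = - l2 *\<^sub>R gq_e 2"
  by (simp_all add: gq_mult_def gq_e_def gq_one_def axis_def vec_eq_iff forall_3)

lemma gq_mult_one: "gq_mult l1 l2 l3 gq_one p = p" "gq_mult l1 l2 l3 p gq_one = p"
  by (simp_all add: gq_mult_def gq_one_def vec_eq_iff forall_3 prod_eq_iff)

lemma gq_mult_assoc:
  "gq_mult l1 l2 l3 (gq_mult l1 l2 l3 p q) r = gq_mult l1 l2 l3 p (gq_mult l1 l2 l3 q r)"
  by (simp add: gq_mult_def vec_eq_iff forall_3 Let_def algebra_simps)

lemma bilinear_gq_mult: "bilinear (gq_mult l1 l2 l3)"
  unfolding bilinear_def
  by (intro conjI allI linearI)
     (simp_all add: gq_mult_def vec_eq_iff forall_3 Let_def algebra_simps)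

lemma gq_norm_eq_mult_conj:
  "gq_mult l1 l2 l3 p (gq_conj p) = gq_norm l1 l2 l3 p *\<^sub>R gq_one"
  "gq_mult l1 l2 l3 (gq_conj p) p = gq_norm l1 l2 l3 p *\<^sub>R gq_one"
  by (simp_all add: gq_mult_def gq_conj_def gq_norm_def gq_one_def vec_eq_iff forall_3 Let_def
      algebra_simps power2_eq_square)

lemma gq_inv_eq_conj:
  assumes "gq_norm l1 l2 l3 p = 1"
  shows "gq_inv l1 l2 l3 p = gq_conj p"
  unfolding gq_inv_def
proof (rule the_equality)
  show "gq_mult l1 l2 l3 p (gq_conj p) = gq_one \<and> gq_mult l1 l2 l3 (gq_conj p) p = gq_one"
    using assms by (simp add: gq_norm_eq_mult_conj)
next
  fix q
  assume q: "gq_mult l1 l2 l3 p q = gq_one \<and> gq_mult l1 l2 l3 q p = gq_one"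
  have "q = gq_mult l1 l2 l3 (gq_mult l1 l2 l3 (gq_conj p) p) q"
    using assms by (simp add: gq_norm_eq_mult_conj gq_mult_one)
  also have "\<dots> = gq_conj p"
    using q by (simp add: gq_mult_assoc gq_mult_one)
  finally show "q = gq_conj p" .
qed

lemma gq_conjugation_Im:
  assumes "gq_norm l1 l2 l3 p = 1" and "q \<in> gq_Im"
  shows "gq_mult l1 l2 l3 (gq_mult l1 l2 l3 p q) (gq_inv l1 l2 l3 p) \<in> gq_Im"
  using assms(2) unfolding gq_inv_eq_conj[OF assms(1)]
  by (simp add: gq_Im_def gq_mult_def gq_conj_def Let_def algebra_simps)

lemma inj_gq_e: "inj gq_e"
  by (auto simp: inj_def gq_e_def axis_eq_axis)

lemma gq_independent: "independent (range gq_e)"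
proof -
  have "pairwise orthogonal (range gq_e)"
    by (auto simp: pairwise_def orthogonal_def gq_e_def inner_axis_axis)
  moreover have "0 \<notin> range gq_e"
    by (auto simp: gq_e_def zero_prod_def axis_eq_0_iff)
  ultimately show ?thesis
    by (rule pairwise_orthogonal_independent)
qed

lemma gq_span: "span (range gq_e) = gq_Im"
proof
  have "subspace gq_Im"
    by (auto simp: subspace_def gq_Im_def)
  then show "span (range gq_e) \<subseteq> gq_Im"
    by (intro span_minimal) (auto simp: gq_Im_def gq_e_def)
  show "gq_Im \<subseteq> span (range gq_e)"
  proof
    fix q assume "q \<in> gq_Im"
    then have "q = (\<Sum>i\<in>UNIV. (snd q $ i) *\<^sub>R gq_e i)"
      by (simp add: gq_Im_def gq_e_def sum_3 prod_eq_iff vec_eq_iff forall_3 axis_def)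
    also have "\<dots> \<in> span (range gq_e)"
      by (intro span_sum span_scale span_base) auto
    finally show "q \<in> span (range gq_e)" .
  qed
qed

end

theory Submission
  imports Defs
begin

text \<open>
  The matrix \<open>\<epsilon>\<close> is the Gram matrix, in the basis \<open>e\<^sub>1, e\<^sub>2, e\<^sub>3\<close>, of the symmetric bilinear form
  \<open>B(q, r) = Re (q r\<^sup>*)\<close>, where \<open>r\<^sup>*\<close> is the conjugate of \<open>r\<close>; it is the polarization of the norm.
  So the theorem says that \<open>q \<mapsto> p q p\<^sup>-\<^sup>1\<close> is an isometry of \<open>B\<close> when \<open>p\<close> has norm 1.  This holds
  because \<open>q \<mapsto> q\<^sup>*\<close> is an involutive anti-automorphism and \<open>Re\<close> behaves like a trace,
  \<open>Re (x y) = Re (y x)\<close>: since \<open>p\<^sup>-\<^sup>1 = p\<^sup>*\<close>,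
  \<open>B(p q p\<^sup>*, p r p\<^sup>*) = Re ((p q p\<^sup>*) (p r\<^sup>* p\<^sup>*)) = Re (p (q r\<^sup>*) p\<^sup>*) = Re (q r\<^sup>* p\<^sup>* p) = B(q, r)\<close>
  (\<open>gq_form_conjugation\<close>).  The \<open>(i, j)\<close> entry of \<open>A\<^sup>T \<epsilon> A\<close> is \<open>\<epsilon>\<close> evaluated on the columns
  \<open>i\<close> and \<open>j\<close> of \<open>A\<close>, and for the adjoint matrix those columns are the coordinates of
  \<open>p e\<^sub>i p\<^sup>-\<^sup>1\<close> and \<open>p e\<^sub>j p\<^sup>-\<^sup>1\<close>; the isometry property turns it into \<open>B(e\<^sub>i, e\<^sub>j) = \<epsilon>\<^sub>i\<^sub>j\<close>.
\<close>

lemma gq_conj_mult: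
  "gq_conj (gq_mult l1 l2 l3 p q) = gq_mult l1 l2 l3 (gq_conj q) (gq_conj p)"
  by (simp add: gq_mult_def gq_conj_def vec_eq_iff forall_3 Let_def algebra_simps)

lemma gq_conj_conj: "gq_conj (gq_conj p) = p"
  by (simp add: gq_conj_def)

lemma fst_gq_mult_commute: "fst (gq_mult l1 l2 l3 p q) = fst (gq_mult l1 l2 l3 q p)"
  by (simp add: gq_mult_def Let_def algebra_simps)

definition gq_form :: "real \<Rightarrow> real \<Rightarrow> real \<Rightarrow> gquat \<Rightarrow> gquat \<Rightarrow> real" where
  "gq_form l1 l2 l3 q r = fst (gq_mult l1 l2 l3 q (gq_conj r))"

text \<open>In the product \<open>(p q p\<^sup>*) (p r p\<^sup>*)\<^sup>*\<close> the inner factors cancel by \<open>p\<^sup>* p = 1\<close>; the outer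
  ones cancel in the same way once the trace property has moved \<open>p\<close> from the left end to the
  right end.\<close>

lemma gq_form_conjugation:
  assumes "gq_norm l1 l2 l3 p = 1"
  shows "gq_form l1 l2 l3
           (gq_mult l1 l2 l3 (gq_mult l1 l2 l3 p q) (gq_inv l1 l2 l3 p))
           (gq_mult l1 l2 l3 (gq_mult l1 l2 l3 p r) (gq_inv l1 l2 l3 p))
         = gq_form l1 l2 l3 q r"
proof -
  let ?m = "gq_mult l1 l2 l3" and ?p' = "gq_conj p" and ?r' = "gq_conj r"
  have unit: "?m ?p' p = gq_one"
    using assms by (simp add: gq_norm_eq_mult_conj)
  then have cancel: "?m ?p' (?m p x) = x" for x
    by (simp add: gq_mult_assoc[symmetric] gq_mult_one)
  have "?m (?m (?m p q) ?p') (gq_conj (?m (?m p r) ?p')) = ?m p (?m q (?m ?r' ?p'))"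
    by (simp add: gq_conj_mult gq_conj_conj gq_mult_assoc cancel)
  moreover have "fst (?m p (?m q (?m ?r' ?p'))) = fst (?m (?m q (?m ?r' ?p')) p)"
    by (rule fst_gq_mult_commute)
  moreover have "?m (?m q (?m ?r' ?p')) p = ?m q ?r'"
    by (simp add: gq_mult_assoc unit gq_mult_one)
  ultimately show ?thesis
    by (simp add: gq_form_def gq_inv_eq_conj[OF assms])
qed

lemma gq_form_Im:
  assumes "q \<in> gq_Im" and "r \<in> gq_Im"
  shows "gq_form l1 l2 l3 q r = snd q \<bullet> (gq_eps l1 l2 l3 *v snd r)"
  using assms
  by (simp add: gq_Im_def gq_form_def gq_mult_def gq_conj_def gq_eps_def Let_def
      inner_vec_def matrix_vector_mult_def sum_3 algebra_simps)

lemma gq_e_in_Im: "gq_e i \<in> gq_Im"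
  by (simp add: gq_e_def gq_Im_def)

lemma representation_gq_e:
  assumes "q \<in> gq_Im"
  shows "representation (range gq_e) q (gq_e i) = snd q $ i"
proof -
  have q: "q = (\<Sum>j\<in>UNIV. (snd q $ j) *\<^sub>R gq_e j)"
    using assms by (simp add: gq_Im_def gq_e_def sum_3 prod_eq_iff vec_eq_iff forall_3 axis_def)
  have "representation (range gq_e) q (gq_e i)
      = (\<Sum>j\<in>UNIV. snd q $ j * representation (range gq_e) (gq_e j) (gq_e i))"
    by (subst q)
      (simp add: gq_independent gq_span gq_e_in_Im representation_sum representation_scale
        subspace_scale[OF subspace_span[of "range gq_e", unfolded gq_span]])
  also have "\<dots> = (\<Sum>j\<in>UNIV. if j = i then snd q $ j else 0)"
    by (intro sum.cong)
      (auto simp: representation_basis[OF gq_independent] dest: injD[OF inj_gq_e])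
  finally show ?thesis
    by simp
qed

lemma column_gq_Ad:
  assumes "gq_norm l1 l2 l3 p = 1"
  shows "column j (gq_Ad l1 l2 l3 p)
         = snd (gq_mult l1 l2 l3 (gq_mult l1 l2 l3 p (gq_e j)) (gq_inv l1 l2 l3 p))"
  by (simp add: column_def gq_Ad_def vec_eq_iff representation_gq_e
      gq_conjugation_Im[OF assms gq_e_in_Im])

lemma transpose_mult_mult_nth:
  fixes A :: "real ^ 'n ^ 'm" and M :: "real ^ 'm ^ 'm"
  shows "(transpose A ** M ** A) $ i $ j = column i A \<bullet> (M *v column j A)"
proof -
  have "(transpose A ** M ** A) $ i $ j = (transpose A ** (M ** A)) $ i $ j"
    by (simp add: matrix_mul_assoc)
  also have "\<dots> = column i A \<bullet> (M *v column j A)"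
    by (simp add: matrix_matrix_mult_def matrix_vector_mult_def transpose_def column_def
        inner_vec_def)
  finally show ?thesis .
qed

theorem theorem5p4:
  fixes l1 l2 l3 :: real and p :: gquat
  assumes "gq_norm l1 l2 l3 p = 1"
  shows "transpose (gq_Ad l1 l2 l3 p) ** gq_eps l1 l2 l3 ** gq_Ad l1 l2 l3 p = gq_eps l1 l2 l3"
proof -
  let ?A = "gq_Ad l1 l2 l3 p" and ?E = "gq_eps l1 l2 l3"
  let ?c = "\<lambda>j. gq_mult l1 l2 l3 (gq_mult l1 l2 l3 p (gq_e j)) (gq_inv l1 l2 l3 p)"
  have "(transpose ?A ** ?E ** ?A) $ i $ j = ?E $ i $ j" for i j
  proof -
    have "(transpose ?A ** ?E ** ?A) $ i $ j = snd (?c i) \<bullet> (?E *v snd (?c j))"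
      by (simp add: transpose_mult_mult_nth column_gq_Ad[OF assms])
    also have "\<dots> = gq_form l1 l2 l3 (?c i) (?c j)"
      by (simp add: gq_form_Im gq_conjugation_Im[OF assms gq_e_in_Im])
    also have "\<dots> = gq_form l1 l2 l3 (gq_e i) (gq_e j)"
      by (rule gq_form_conjugation[OF assms])
    also have "\<dots> = axis i 1 \<bullet> (?E *v axis j 1)"
      by (subst gq_form_Im[OF gq_e_in_Im gq_e_in_Im]) (simp add: gq_e_def)
    also have "\<dots> = ?E $ i $ j"
      by (simp add: inner_axis' matrix_vector_mult_basis column_def)
    finally show ?thesis .
  qed
  then show ?thesis
    by (simp add: vec_eq_iff)
qed

end
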